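(* Let $\delta$ be the Steiner tree diversity on $\mathbb{R}^3$ with the Euclidean metric. Then $\delta$ is unbounded on every nonempty open set of the Euclidean topology; that is, for every nonempty open set $O\subseteq\mathbb{R}^3$ and every $M>0$ there is a finite set $A\subseteq O$ with $\delta(A)>M$.
   Context: For a metric space $(X,d)$, the Steiner tree diversity is the function $\delta$ on finite subsets of $X$ where $\delta(A)$ is the infimum of the sizes of Steiner trees on $A$. A Steiner tree on $A$ is a (finite) tree whose vertex set $V$ satisfies $A\subseteq V\subseteq X$, with each edge $(x,y)$ weighted by $d(x,y)$; its size is the sum of its edge weights. (In particular $\delta(A)=0$ if $|A|\le 1$.) *)

theory Defs
  imports "HOL-Analysis.Analysis"
begin

text \<open>
  Finite simple undirected graphs are given by a vertex set \<open>V\<close> and a set \<open>E\<close> of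
  two-element sets of vertices.
\<close>

definition simple_graph :: "'a set \<Rightarrow> 'a set set \<Rightarrow> bool" where
  "simple_graph V E \<longleftrightarrow>
     finite V \<and> E \<subseteq> {{x, y} | x y. x \<in> V \<and> y \<in> V \<and> x \<noteq> y}"

definition graph_connected :: "'a set \<Rightarrow> 'a set set \<Rightarrow> bool" where
  "graph_connected V E \<longleftrightarrow>
     V \<noteq> {} \<and> (\<forall>x\<in>V. \<forall>y\<in>V. (x, y) \<in> {(u, v). {u, v} \<in> E}\<^sup>*)"

definition graph_cycle :: "'a set set \<Rightarrow> 'a list \<Rightarrow> bool" where
  "graph_cycle E vs \<longleftrightarrow>
     3 \<le> length vs \<and> distinct vs \<and>
     (\<forall>i<length vs. {vs ! i, vs ! (Suc i mod length vs)} \<in> E)"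

definition graph_tree :: "'a set \<Rightarrow> 'a set set \<Rightarrow> bool" where
  "graph_tree V E \<longleftrightarrow>
     simple_graph V E \<and> graph_connected V E \<and> \<not> (\<exists>vs. graph_cycle E vs)"

definition edge_weight :: "'a::metric_space set \<Rightarrow> real" where
  "edge_weight e = (THE w. \<exists>x y. e = {x, y} \<and> w = dist x y)"

lemma edge_weight_doubleton [simp]: "edge_weight {x, y} = dist x y"
  unfolding edge_weight_def by (rule the_equality) (auto simp: doubleton_eq_iff dist_commute)

definition tree_size :: "'a::metric_space set set \<Rightarrow> real" where
  "tree_size E = (\<Sum>e\<in>E. edge_weight e)"

definition steiner_tree :: "'a set \<Rightarrow> 'a set \<Rightarrow> 'a set set \<Rightarrow> bool" where
  "steiner_tree A V E \<longleftrightarrow> A \<subseteq> V \<and> graph_tree V E"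

text \<open>
  Intended for finite \<open>A\<close>, where the infimum ranges over a nonempty set of nonnegative
  reals; see \<open>steiner_tree_exists\<close> and \<open>tree_size_nonneg\<close>.
\<close>

definition steiner_diversity :: "'a::metric_space set \<Rightarrow> real" where
  "steiner_diversity A = Inf {tree_size E | V E. steiner_tree A V E}"

lemma tree_size_nonneg:
  assumes "steiner_tree A V E"
  shows "0 \<le> tree_size E"
  unfolding tree_size_def
proof (rule sum_nonneg)
  fix e assume "e \<in> E"
  then obtain x y where "e = {x, y}"
    using assms unfolding steiner_tree_def graph_tree_def simple_graph_def by blast
  then show "0 \<le> edge_weight e" by simp
qed

lemma steiner_tree_exists:
  assumes "finite A"
  shows "\<exists>V E. steiner_tree A V E"
proof -
  obtain r where r: "A \<noteq> {} \<longrightarrow> r \<in> A" by blast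
  define E where "E = {{r, y} | y. y \<in> A \<and> y \<noteq> r}"
  have "simple_graph (insert r A) E"
    using assms unfolding simple_graph_def E_def by auto
  moreover have "graph_connected (insert r A) E"
    unfolding graph_connected_def
  proof (intro conjI ballI)
    fix x y assume xy: "x \<in> insert r A" "y \<in> insert r A"
    let ?R = "{(u, v). {u, v} \<in> E}"
    have "(x, r) \<in> ?R\<^sup>*"
      using xy by (cases "x = r") (auto simp: E_def insert_commute intro!: r_into_rtrancl)
    moreover have "(r, y) \<in> ?R\<^sup>*"
      using xy by (cases "y = r") (auto simp: E_def intro!: r_into_rtrancl)
    ultimately show "(x, y) \<in> ?R\<^sup>*" by (rule rtrancl_trans)
  qed simp
  moreover have "\<not> graph_cycle E vs" for vs
  proof
    assume c: "graph_cycle E vs"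
    let ?n = "length vs"
    have n: "3 \<le> ?n" and d: "distinct vs"
      using c by (auto simp: graph_cycle_def)
    have ne0: "0 < ?n" "1 < ?n" "2 < ?n" "3 mod ?n < ?n"
      using n by (auto intro!: mod_less_divisor)
    have e: "r = vs ! i \<or> r = vs ! (Suc i mod ?n)" if "i < ?n" for i
      using c that unfolding graph_cycle_def E_def by blast
    have ne: "vs ! i \<noteq> vs ! j" if "i < ?n" "j < ?n" "i \<noteq> j" for i j
      using d that by (simp add: nth_eq_iff_index_eq)
    have "Suc 0 mod ?n = 1" "Suc 1 mod ?n = 2" "Suc 2 = 3"
      using n by auto
    then have *: "r = vs ! 0 \<or> r = vs ! 1" "r = vs ! 1 \<or> r = vs ! 2"
        "r = vs ! 2 \<or> r = vs ! (3 mod ?n)"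
      using e[OF ne0(1)] e[OF ne0(2)] e[OF ne0(3)] by metis+
    have "3 mod ?n \<noteq> 1" by (cases "?n = 3") (use n in auto)
    then have "vs ! 0 \<noteq> vs ! 2" "vs ! 1 \<noteq> vs ! 2" "vs ! 1 \<noteq> vs ! (3 mod ?n)"
      using ne ne0 by simp_all
    with * show False by metis
  qed
  ultimately show ?thesis
    unfolding steiner_tree_def graph_tree_def by blast
qed

end

theory Submission
  imports Defs "HOL-Library.Transitive_Closure_Table"
begin

text \<open>
  A Steiner tree on \<open>n\<close> points at mutual distance at least \<open>h\<close> has size at least \<open>n * h / 2\<close>: the
  balls of radius \<open>h / 2\<close> about the points are disjoint, and the tree must reach from each centre
  to the outside of its ball. A square grid of \<open>k * k\<close> points inside a fixed ball has spacing of
  order \<open>1 / k\<close>, so its Steiner trees have size at least of order \<open>k\<close>, which is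
  unbounded. Two dimensions are enough for this, so the same argument works in every Euclidean
  space of dimension at least two.

  Speaking of the part of an edge that lies in a ball would require the edges to be curves. The
  bump functions \<open>x \<mapsto> max 0 (h / 2 - d a x)\<close> replace the balls and make the count valid in
  any metric space. Each bump varies by at least \<open>h / 2\<close> over the tree, because it
  falls from \<open>h / 2\<close> at its own point to \<open>0\<close> at any other one
  (\<open>dist_le_sum_edge_variation\<close>). Since the supports are disjoint, the variations of
  all bumps along one edge add up to at most the length of that edge
  (\<open>sum_bump_variation_le_dist\<close>). Summing over edges gives the bound.
\<close>

section \<open>Variation of a function over a connected graph\<close>

text \<open>
  For a two-element \<open>e\<close>, \<open>edge_weight (g ` e)\<close> is the distance between the values of \<open>g\<close> at the
  ends of \<open>e\<close>. The sum on the right counts every edge once, so the triangle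
  inequality has to be applied along a path that repeats no edge. On a path without repeated
  vertices, the first edge is not contained in the vertex set of the rest; restricting the sum
  to the edges within the vertex set of the path lets the induction use this.
\<close>

lemma dist_le_sum_edge_variation_along_path:
  fixes g :: "'a \<Rightarrow> 'b::metric_space"
  assumes "rtrancl_path (\<lambda>u v. {u, v} \<in> E) x xs y"
    and "distinct (x # xs)"
    and "finite E"
    and "\<And>e. e \<in> E \<Longrightarrow> \<exists>u v. e = {u, v}"
  shows "dist (g x) (g y) \<le> (\<Sum>e \<in> {e \<in> E. e \<subseteq> set (x # xs)}. edge_weight (g ` e))"
proof -
  have nonneg: "0 \<le> edge_weight (g ` e)" if "e \<in> E" for e
    using assms(4)[OF that] by auto
  show ?thesis
    using assms(1,2)
  proof (induction rule: rtrancl_path.induct)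
    case (base x)
    show ?case
      unfolding dist_self by (rule sum_nonneg) (use nonneg in blast)
  next
    case (step x y ys z)
    let ?F = "\<lambda>S. {e \<in> E. e \<subseteq> S}"
    have IH: "dist (g y) (g z) \<le> (\<Sum>e \<in> ?F (set (y # ys)). edge_weight (g ` e))"
      using step by simp
    have new: "{x, y} \<notin> ?F (set (y # ys))"
      using step.prems by auto
    have "dist (g x) (g z) \<le> dist (g x) (g y) + dist (g y) (g z)"
      by (rule dist_triangle)
    also have "\<dots> \<le> edge_weight (g ` {x, y}) + (\<Sum>e \<in> ?F (set (y # ys)). edge_weight (g ` e))"
      using IH by simp
    also have "\<dots> = (\<Sum>e \<in> insert {x, y} (?F (set (y # ys))). edge_weight (g ` e))"
      using new assms(3) by (subst sum.insert) auto
    also have "\<dots> \<le> (\<Sum>e \<in> ?F (set (x # y # ys)). edge_weight (g ` e))"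
    proof (rule sum_mono2)
      show "finite (?F (set (x # y # ys)))"
        using assms(3) by simp
      show "insert {x, y} (?F (set (y # ys))) \<subseteq> ?F (set (x # y # ys))"
        using step.hyps(1) by auto
      fix e assume "e \<in> ?F (set (x # y # ys)) - insert {x, y} (?F (set (y # ys)))"
      then show "0 \<le> edge_weight (g ` e)"
        using nonneg[of e] by blast
    qed
    finally show ?case .
  qed
qed

lemma dist_le_sum_edge_variation:
  fixes g :: "'a \<Rightarrow> 'b::metric_space"
  assumes "simple_graph V E" and "graph_connected V E" and "x \<in> V" and "y \<in> V"
  shows "dist (g x) (g y) \<le> (\<Sum>e\<in>E. edge_weight (g ` e))"
proof -
  have E: "\<exists>u v. e = {u, v}" if "e \<in> E" for e
    using that assms(1) unfolding simple_graph_def by blast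
  have "E \<subseteq> Pow V" and "finite V"
    using assms(1) unfolding simple_graph_def by auto
  then have fin: "finite E"
    by (meson finite_Pow_iff finite_subset)
  have "(\<lambda>u v. {u, v} \<in> E)\<^sup>*\<^sup>* x y"
    using assms(2-4) unfolding graph_connected_def by (simp add: rtranclp_rtrancl_eq)
  then obtain xs where "rtrancl_path (\<lambda>u v. {u, v} \<in> E) x xs y"
    by (auto simp: rtranclp_eq_rtrancl_path)
  then obtain ys where ys: "rtrancl_path (\<lambda>u v. {u, v} \<in> E) x ys y" "distinct (x # ys)"
    by (rule rtrancl_path_distinct)
  have "dist (g x) (g y) \<le> (\<Sum>e \<in> {e \<in> E. e \<subseteq> set (x # ys)}. edge_weight (g ` e))"
    by (rule dist_le_sum_edge_variation_along_path[OF ys fin E])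
  also have "\<dots> \<le> (\<Sum>e\<in>E. edge_weight (g ` e))"
  proof (rule sum_mono2[OF fin])
    fix e assume "e \<in> E - {e \<in> E. e \<subseteq> set (x # ys)}"
    then obtain u v where "e = {u, v}"
      using E by blast
    then show "0 \<le> edge_weight (g ` e)"
      by simp
  qed blast
  finally show ?thesis .
qed

section \<open>Disjoint bumps and the lower bound for separated sets\<close>

definition bump :: "real \<Rightarrow> 'a::metric_space \<Rightarrow> 'a \<Rightarrow> real" where
  "bump r a x = max 0 (r - dist a x)"

lemma bump_lipschitz: "dist (bump r a x) (bump r a y) \<le> dist x y"
proof -
  have "dist a x \<le> dist a y + dist x y" "dist a y \<le> dist a x + dist x y"
    using dist_triangle[of a x y] dist_triangle[of a y x] by (simp_all add: dist_commute)
  then show ?thesis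
    unfolding bump_def dist_real_def by linarith
qed

text \<open>
  Each of \<open>x\<close> and \<open>y\<close> lies in at most one ball, so at most two bumps contribute. When one
  contributes, its Lipschitz property suffices. When \<open>x\<close> is near \<open>a\<close> and \<open>y\<close> is near \<open>b \<noteq> a\<close>, the
  contributions are \<open>h / 2 - d a x\<close> and \<open>h / 2 - d b y\<close>, and the path from \<open>a\<close> over \<open>x\<close> and
  \<open>y\<close> to \<open>b\<close> has length at least \<open>h\<close>.
\<close>

lemma sum_bump_variation_le_dist:
  fixes A :: "'a::metric_space set"
  assumes "finite A"
    and sep: "\<And>a b. \<lbrakk>a \<in> A; b \<in> A; a \<noteq> b\<rbrakk> \<Longrightarrow> h \<le> dist a b"
  shows "(\<Sum>a\<in>A. dist (bump (h / 2) a x) (bump (h / 2) a y)) \<le> dist x y"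
proof -
  let ?\<phi> = "bump (h / 2)"
  let ?v = "\<lambda>a. dist (?\<phi> a x) (?\<phi> a y)"
  have zero: "?\<phi> a z = 0" if "\<not> dist a z < h / 2" for a z :: 'a
    using that by (simp add: bump_def)
  have uniq: "a = b" if "a \<in> A" "b \<in> A" "dist a z < h / 2" "dist b z < h / 2" for a b z
  proof (rule ccontr)
    assume "a \<noteq> b"
    then have "h \<le> dist a b"
      using sep that by blast
    also have "\<dots> \<le> dist a z + dist b z"
      by (rule dist_triangle2)
    finally show False
      using that by simp
  qed
  have restrict: "sum ?v A = sum ?v S"
    if "S \<subseteq> A" "\<And>a. \<lbrakk>a \<in> A; a \<notin> S\<rbrakk> \<Longrightarrow> \<not> dist a x < h / 2 \<and> \<not> dist a y < h / 2" for S
    proof (rule sum.mono_neutral_right[OF assms(1) that(1)])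
    show "\<forall>a \<in> A - S. ?v a = 0"
      using that(2) zero by (metis DiffE dist_self)
  qed
  have single: ?thesis if "a \<in> A" "\<And>b. \<lbrakk>b \<in> A; b \<noteq> a\<rbrakk> \<Longrightarrow> \<not> dist b x < h / 2 \<and> \<not> dist b y < h / 2" for a
    using restrict[of "{a}"] that bump_lipschitz[of "h / 2" a x y] by simp
  consider (none) "\<forall>a\<in>A. \<not> dist a x < h / 2 \<and> \<not> dist a y < h / 2"
    | (left) a where "a \<in> A" "dist a x < h / 2" "\<forall>b\<in>A. \<not> dist b y < h / 2"
    | (right) b where "b \<in> A" "dist b y < h / 2" "\<forall>a\<in>A. \<not> dist a x < h / 2"
    | (both) a b where "a \<in> A" "b \<in> A" "dist a x < h / 2" "dist b y < h / 2"
    by blast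
  then show ?thesis
  proof cases
    case none
    then show ?thesis
      using restrict[of "{}"] by simp
  next
    case (left a)
    then show ?thesis
      using single[of a] uniq by blast
  next
    case (right b)
    then show ?thesis
      using single[of b] uniq by blast
  next
    case (both a b)
    show ?thesis
    proof (cases "a = b")
      case True
      then show ?thesis
        using both single[of a] uniq by blast
    next
      case False
      have "\<not> dist c x < h / 2 \<and> \<not> dist c y < h / 2" if "c \<in> A" "c \<notin> {a, b}" for c
        using both that uniq by blast
      then have sum: "sum ?v A = ?v a + ?v b"
        using restrict[of "{a, b}"] both False by simp
      have "\<not> dist a y < h / 2" and "\<not> dist b x < h / 2"
        using both False uniq by blast+
      then have "?v a = h / 2 - dist a x" "?v b = h / 2 - dist b y"
        using both by (simp_all add: zero) (simp_all add: bump_def)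
      moreover have "h \<le> dist a x + dist x y + dist b y"
        using sep[OF both(1,2) False] dist_triangle[of a b x] dist_triangle[of x b y]
        by (simp add: dist_commute)
      ultimately show ?thesis
        using sum by simp
    qed
  qed
qed

text \<open>
  Double counting: the total variation of all bumps over all edges is at most the size of the
  tree when summed edge by edge, and at least \<open>h / 2\<close> for every bump. A second point of \<open>A\<close> is
  what forces each bump to vanish somewhere on the tree.
\<close>

lemma steiner_tree_size_ge_separated:
  fixes A :: "'a::metric_space set"
  assumes tree: "steiner_tree A V E"
    and card: "2 \<le> card A"
    and sep: "\<And>a b. \<lbrakk>a \<in> A; b \<in> A; a \<noteq> b\<rbrakk> \<Longrightarrow> h \<le> dist a b"
  shows "real (card A) * (h / 2) \<le> tree_size E"
proof -
  have V: "A \<subseteq> V" "simple_graph V E" "graph_connected V E"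
    using tree unfolding steiner_tree_def graph_tree_def by auto
  have fin: "finite A"
    using card by (metis card.infinite not_numeral_le_zero)
  have per_bump: "h / 2 \<le> (\<Sum>e\<in>E. edge_weight (bump (h / 2) a ` e))" if "a \<in> A" for a
  proof -
    have "\<not> A \<subseteq> {a}"
      using card card_mono[of "{a}" A] by auto
    then obtain b where b: "b \<in> A" "b \<noteq> a"
      by blast
    then have "h \<le> dist a b"
      using sep that by blast
    then have "h / 2 \<le> dist (bump (h / 2) a a) (bump (h / 2) a b)"
      using zero_le_dist[of a b] unfolding bump_def dist_real_def dist_self by linarith
    also have "\<dots> \<le> (\<Sum>e\<in>E. edge_weight (bump (h / 2) a ` e))"
      using V b that by (intro dist_le_sum_edge_variation[of V]) auto
    finally show ?thesis .
  qed
  have per_edge: "(\<Sum>a\<in>A. edge_weight (bump (h / 2) a ` e)) \<le> edge_weight e" if e: "e \<in> E" for e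
  proof -
    obtain x y where "e = {x, y}"
      using e V(2) unfolding simple_graph_def by blast
    then show ?thesis
      using sum_bump_variation_le_dist[OF fin sep, of x y] by simp
  qed
  have "real (card A) * (h / 2) = (\<Sum>a\<in>A. h / 2)"
    by simp
  also have "\<dots> \<le> (\<Sum>a\<in>A. \<Sum>e\<in>E. edge_weight (bump (h / 2) a ` e))"
    by (rule sum_mono) (rule per_bump)
  also have "\<dots> = (\<Sum>e\<in>E. \<Sum>a\<in>A. edge_weight (bump (h / 2) a ` e))"
    by (rule sum.swap)
  also have "\<dots> \<le> tree_size E"
    unfolding tree_size_def by (rule sum_mono) (rule per_edge)
  finally show ?thesis .
qed

lemma steiner_diversity_ge_separated:
  fixes A :: "'a::metric_space set"
  assumes card: "2 \<le> card A"
    and sep: "\<And>a b. \<lbrakk>a \<in> A; b \<in> A; a \<noteq> b\<rbrakk> \<Longrightarrow> h \<le> dist a b"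
  shows "real (card A) * (h / 2) \<le> steiner_diversity A"
  unfolding steiner_diversity_def
proof (rule cInf_greatest)
  have "finite A"
    using card by (metis card.infinite not_numeral_le_zero)
  then show "{tree_size E | V E. steiner_tree A V E} \<noteq> {}"
    using steiner_tree_exists by blast
next
  fix w assume "w \<in> {tree_size E | V E. steiner_tree A V E}"
  then obtain V E where "w = tree_size E" and tree: "steiner_tree A V E"
    by blast
  moreover have "real (card A) * (h / 2) \<le> tree_size E"
    using tree card sep by (rule steiner_tree_size_ge_separated)
  ultimately show "real (card A) * (h / 2) \<le> w"
    by simp
qed

section \<open>Fine grids in a ball\<close>

lemma separated_grid_in_ball:
  fixes p :: "'a::euclidean_space"
  assumes "2 \<le> DIM('a)" and "0 < r" and "0 < k"
  obtains A where "finite A" "A \<subseteq> ball p r" "card A = k * k"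
    "\<And>a b. \<lbrakk>a \<in> A; b \<in> A; a \<noteq> b\<rbrakk> \<Longrightarrow> r / (2 * real k) \<le> dist a b"
proof -
  have "\<not> DIM('a) \<le> Suc 0"
    using assms(1) by simp
  then obtain u v :: 'a where uv: "u \<in> Basis" "v \<in> Basis" "u \<noteq> v"
    unfolding card_le_Suc0_iff_eq[OF finite_Basis] by blast
  define h where "h = r / (2 * real k)"
  have h: "h > 0"
    using assms by (simp add: h_def)
  define q where "q = (\<lambda>(i, j). p + ((h * real i) *\<^sub>R u + (h * real j) *\<^sub>R v))"
  let ?I = "{..<k} \<times> {..<k}"
  have spacing: "h \<le> dist (q s) (q t)" if "s \<noteq> t" for s t
  proof -
    obtain i j i' j' where st: "s = (i, j)" "t = (i', j')"
      by (cases s, cases t) auto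
    have "(q s - q t) \<bullet> u = h * (real i - real i')" "(q s - q t) \<bullet> v = h * (real j - real j')"
      using uv by (simp_all add: q_def st inner_Basis algebra_simps)
    then have *: "h * \<bar>real i - real i'\<bar> \<le> dist (q s) (q t)" "h * \<bar>real j - real j'\<bar> \<le> dist (q s) (q t)"
      using Basis_le_norm[OF uv(1), of "q s - q t"] Basis_le_norm[OF uv(2), of "q s - q t"] h
      by (simp_all add: abs_mult dist_norm)
    have "1 \<le> \<bar>real i - real i'\<bar> \<or> 1 \<le> \<bar>real j - real j'\<bar>"
      using that st by (cases "i = i'") auto
    then show ?thesis
      using * h by (metis mult.right_neutral mult_le_cancel_left_pos order_trans)
  qed
  have "inj_on q ?I"
  proof (rule inj_onI, rule ccontr)
    fix s t assume "q s = q t" and "s \<noteq> t"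
    then show False
      using spacing[of s t] h by simp
  qed
  then have card: "card (q ` ?I) = k * k"
    by (simp add: card_image)
  have sub: "q ` ?I \<subseteq> ball p r"
  proof clarify
    fix i j assume ij: "i < k" "j < k"
    have "dist p (q (i, j)) = norm ((h * real i) *\<^sub>R u + (h * real j) *\<^sub>R v)"
      unfolding q_def prod.case by (subst dist_commute) (simp add: dist_norm)
    also have "\<dots> \<le> h * real i + h * real j"
      using uv h norm_triangle_ineq[of "(h * real i) *\<^sub>R u" "(h * real j) *\<^sub>R v"] by simp
    also have "\<dots> < h * real k + h * real k"
      using ij h by (intro add_strict_mono) auto
    also have "\<dots> = r"
      using assms(3) by (simp add: h_def)
    finally show "q (i, j) \<in> ball p r"
      by simp
  qed
  show ?thesis
  proof (rule that[OF _ sub card])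
    fix a b assume "a \<in> q ` ?I" "b \<in> q ` ?I" "a \<noteq> b"
    then obtain s t where "a = q s" "b = q t" "s \<noteq> t"
      by blast
    then show "r / (2 * real k) \<le> dist a b"
      using spacing[of s t] by (simp add: h_def)
  qed simp
qed

theorem steiner_diversity_unbounded_on_open:
  fixes U :: "'a::euclidean_space set"
  assumes "2 \<le> DIM('a)" and "open U" and "U \<noteq> {}"
  shows "\<exists>A. finite A \<and> A \<subseteq> U \<and> steiner_diversity A > M"
proof -
  obtain p r where r: "0 < r" "ball p r \<subseteq> U"
    using assms(2,3) by (metis all_not_in_conv open_contains_ball)
  \<comment> \<open>The bound for \<open>k * k\<close> points at spacing \<open>r / (2 * k)\<close> is \<open>k * r / 4\<close>, hence the threshold
    \<open>4 * M / r\<close>; adding \<open>2\<close> ensures that the grid has at least two points.\<close>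
  obtain n :: nat where n: "4 * M / r < real n"
    using reals_Archimedean2 by blast
  define k where "k = n + 2"
  have "0 < k"
    by (simp add: k_def)
  obtain A where A: "finite A" "A \<subseteq> ball p r" "card A = k * k"
    "\<And>a b. \<lbrakk>a \<in> A; b \<in> A; a \<noteq> b\<rbrakk> \<Longrightarrow> r / (2 * real k) \<le> dist a b"
    using separated_grid_in_ball[of r k p thesis] assms(1) r(1) by (auto simp: k_def)
  have "4 * M / r < real k"
    using n by (simp add: k_def)
  then have "M < real k * r / 4"
    using r(1) by (simp add: field_simps)
  also have "\<dots> = real (card A) * (r / (2 * real k) / 2)"
    using \<open>0 < k\<close> by (simp add: A(3))
  also have "\<dots> \<le> steiner_diversity A"
    by (rule steiner_diversity_ge_separated[OF _ A(4)]) (simp_all add: A(3) k_def)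
  finally show ?thesis
    using A(1,2) r(2) by blast
qed

theorem theorem1:
  fixes U :: "(real ^ 3) set" and M :: real
  assumes "open U" and "U \<noteq> {}" and "M > 0"
  shows "\<exists>A. finite A \<and> A \<subseteq> U \<and> steiner_diversity A > M"
  using assms(1,2) by (intro steiner_diversity_unbounded_on_open) simp_all

end
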